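(* Let $G$ be a group, let $\mathcal{N}$ be a non-empty filtering family of finite index normal subgroups of $G$, and let $\mathcal{H}$ be a URS of $G$. Then the following hold: (1) The map $\mathcal{H} \to \mathrm{Sub}(G)$, $H \mapsto \mathrm{cl}_{\mathcal{N}}(H)$, is upper semi-continuous. (2) There exists a unique URS of $G$ contained in the closure $\overline{\{ \mathrm{cl}_{\mathcal{N}}(H) : H \in \mathcal{H} \}}$ (closure taken in $\mathrm{Sub}(G)$).
   Context: $G$ is regarded as a discrete group. $\mathrm{Sub}(G)$ is the set of subgroups of $G$ with the topology induced from the product topology on $\{0,1\}^G$; it is a compact space on which $G$ acts by conjugation. A URS (uniformly recurrent subgroup) of $G$ is a non-empty closed $G$-invariant subset of $\mathrm{Sub}(G)$ that is minimal (every $G$-orbit in it is dense in it). A family $\mathcal{N}$ of normal subgroups of $G$ is filtering if for all $N_1,N_2\in\mathcal{N}$ there is $N_3\in\mathcal{N}$ with $N_3\leq N_1\cap N_2$. Then the cosets $gN$ ($g\in G$, $N\in\mathcal{N}$) form a basis of a group topology $\tau_{\mathcal{N}}$ on $G$, and for a subgroup $H$ of $G$, $\mathrm{cl}_{\mathcal{N}}(H)$ denotes the closure of $H$ for $\tau_{\mathcal{N}}$, which equals $\bigcap_{N\in\mathcal{N}}HN$. A map $\varphi: X\to \mathrm{Sub}(G)$ on a topological space $X$ is upper semi-continuous if for every finite subset $K$ of $G$ the set $\{x\in X : \varphi(x)\cap K=\emptyset\}$ is open in $X$. (The unique URS in (2) is denoted $\mathrm{cl}_{\mathcal{N}}(\mathcal{H})$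 and called the $\tau_{\mathcal{N}}$-closure of $\mathcal{H}$.) *)

theory Defs
  imports "HOL-Analysis.Analysis" "HOL-Algebra.Group_Action"
begin

definition subgroups_of :: "('a, 'b) monoid_scheme \<Rightarrow> 'a set set" where
  "subgroups_of G = {H. subgroup H G}"

text \<open>A subgroup is identified with its characteristic function on the carrier; the topology
  is then induced from the product of discrete two-point spaces.\<close>

definition Sub_topology :: "('a, 'b) monoid_scheme \<Rightarrow> 'a set topology" where
  "Sub_topology G =
     pullback_topology (subgroups_of G)
       (\<lambda>H. \<lambda>g\<in>carrier G. g \<in> H)
       (product_topology (\<lambda>_. discrete_topology (UNIV :: bool set)) (carrier G))"

definition conj_subgroup :: "('a, 'b) monoid_scheme \<Rightarrow> 'a \<Rightarrow> 'a set \<Rightarrow> 'a set" where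
  "conj_subgroup G g H = (g <#\<^bsub>G\<^esub> H) #>\<^bsub>G\<^esub> (inv\<^bsub>G\<^esub> g)"

definition URS :: "('a, 'b) monoid_scheme \<Rightarrow> 'a set set \<Rightarrow> bool" where
  "URS G X \<longleftrightarrow>
     X \<noteq> {} \<and> closedin (Sub_topology G) X \<and>
     (\<forall>g\<in>carrier G. \<forall>H\<in>X. conj_subgroup G g H \<in> X) \<and>
     (\<forall>H\<in>X. subtopology (Sub_topology G) X closure_of (orbit G (conj_subgroup G) H) = X)"

definition filtering :: "'a set set \<Rightarrow> bool" where
  "filtering \<N> \<longleftrightarrow> (\<forall>N1\<in>\<N>. \<forall>N2\<in>\<N>. \<exists>N3\<in>\<N>. N3 \<subseteq> N1 \<inter> N2)"

text \<open>For a non-empty filtering family of normal subgroups the generating cosets form a base.\<close>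

definition coset_topology :: "('a, 'b) monoid_scheme \<Rightarrow> 'a set set \<Rightarrow> 'a topology" where
  "coset_topology G \<N> =
     topology_generated_by {g <#\<^bsub>G\<^esub> N | g N. g \<in> carrier G \<and> N \<in> \<N>}"

definition coset_closure :: "('a, 'b) monoid_scheme \<Rightarrow> 'a set set \<Rightarrow> 'a set \<Rightarrow> 'a set" where
  "coset_closure G \<N> H = coset_topology G \<N> closure_of H"

definition upper_semicontinuous_map ::
    "'x topology \<Rightarrow> ('a, 'b) monoid_scheme \<Rightarrow> ('x \<Rightarrow> 'a set) \<Rightarrow> bool" where
  "upper_semicontinuous_map X G \<phi> \<longleftrightarrow>
     \<phi> \<in> topspace X \<rightarrow> subgroups_of G \<and>
     (\<forall>K. finite K \<and> K \<subseteq> carrier G \<longrightarrow> openin X {x \<in> topspace X. \<phi> x \<inter> K = {}})"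

end

theory Submission
  imports Defs "HOL-Algebra.Zassenhaus"
begin

text \<open>The \<open>\<tau>\<close>-closure of \<open>H\<close> is the intersection of the subgroups \<open>HN\<close>, \<open>N \<in> \<N>\<close>
  (\<open>coset_closure_eq_Inter\<close>), so its upper semi-continuity on \<open>\<H>\<close> follows once, for each single
  \<open>N\<close>, the map \<open>H \<mapsto> HN\<close> is locally constant on \<open>\<H>\<close>. On all of \<open>Sub(G)\<close> this map is only lower
  semi-continuous: since \<open>N\<close> has finite index, \<open>HN\<close> is already determined by finitely many
  elements of \<open>H\<close>, and every subgroup \<open>K\<close> containing these satisfies \<open>HN \<subseteq> KN\<close>
  (\<open>set_mult_finite_witness\<close>). Minimality of \<open>\<H>\<close> excludes strict inclusions
  (\<open>set_mult_eq_on_URS\<close>). Indeed, only finitely many subgroups \<open>HN\<close> occur. Any \<open>H\<close> in \<open>\<H>\<close> has a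
  conjugate close to a point at which the value is maximal, so the conjugate takes that maximal
  value; hence \<open>HN\<close>, being conjugate to it, is maximal as well.

  The second part holds for every equivariant upper semi-continuous map \<open>f\<close> from a URS \<open>X\<close> to
  \<open>Sub(G)\<close> (\<open>unique_URS_of_semicontinuous_map\<close>). Existence is Zorn's lemma in the compact space
  \<open>Sub(G)\<close> (\<open>exists_URS_subset\<close>). For uniqueness, write \<open>Z\<close> for the closure of \<open>f(X)\<close> and let
  \<open>Y\<^sub>1\<close>, \<open>Y\<^sub>2\<close> be two URSs in \<open>Z\<close>. Upper semi-continuity says that the relation \<open>K \<subseteq> f(H)\<close> is closed,
  and by compactness the projections of closed relations are closed. Thus every element of \<open>Z\<close> lies
  in some \<open>f(H)\<close>; by minimality of \<open>X\<close>, every \<open>f(H)\<close> contains an element of \<open>Y\<^sub>1\<close>; passing to the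
  closure, every element of \<open>Y\<^sub>2\<close> contains an element of \<open>Y\<^sub>1\<close>; and by minimality of \<open>Y\<^sub>1\<close>, every
  element of \<open>Y\<^sub>1\<close> is contained in an element of \<open>Y\<^sub>2\<close>. The same holds with \<open>Y\<^sub>1\<close> and \<open>Y\<^sub>2\<close>
  exchanged, so an inclusion-maximal element of \<open>Y\<^sub>1\<close> is squeezed between \<open>Y\<^sub>1\<close> and \<open>Y\<^sub>2\<close> and belongs to
  both. Minimal sets that meet are equal.\<close>

section \<open>The space of subgroups\<close>

lemma topspace_Sub_topology [simp]: "topspace (Sub_topology G) = subgroups_of G"
  by (auto simp: Sub_topology_def topspace_pullback_topology)

text \<open>The sets \<open>{H. g \<in> H}\<close> and their complements form a subbase of the topology of \<open>Sub(G)\<close>, so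
  continuity can be tested on them; the pullback along characteristic functions need not be
  unfolded again.\<close>

lemma continuous_map_into_Sub:
  "continuous_map X (Sub_topology G) f \<longleftrightarrow>
     f \<in> topspace X \<rightarrow> subgroups_of G \<and>
     (\<forall>g\<in>carrier G. openin X {x \<in> topspace X. g \<in> f x} \<and> closedin X {x \<in> topspace X. g \<in> f x})"
  (is "?lhs \<longleftrightarrow> ?rhs")
proof -
  let ?D = "discrete_topology (UNIV :: bool set)"
  let ?P = "product_topology (\<lambda>_. ?D) (carrier G)"
  let ?\<chi> = "\<lambda>H. \<lambda>g\<in>carrier G. g \<in> H"
  have coord: "continuous_map X ?D (\<lambda>x. g \<in> f x) \<longleftrightarrow>
      openin X {x \<in> topspace X. g \<in> f x} \<and> closedin X {x \<in> topspace X. g \<in> f x}" for g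
  proof
    assume cont: "continuous_map X ?D (\<lambda>x. g \<in> f x)"
    show "openin X {x \<in> topspace X. g \<in> f x} \<and> closedin X {x \<in> topspace X. g \<in> f x}"
      using openin_continuous_map_preimage[OF cont, of "{True}"]
        closedin_continuous_map_preimage[OF cont, of "{True}"] by simp
  next
    assume clopen: "openin X {x \<in> topspace X. g \<in> f x} \<and> closedin X {x \<in> topspace X. g \<in> f x}"
    then have "openin X {x \<in> topspace X. g \<notin> f x}"
      by (simp add: closedin_def set_diff_eq) (smt (verit) Collect_cong)
    moreover have "{x \<in> topspace X. (g \<in> f x) \<in> U} =
        (if True \<in> U then {x \<in> topspace X. g \<in> f x} else {}) \<union>
        (if False \<in> U then {x \<in> topspace X. g \<notin> f x} else {})" for U
      by (auto split: if_splits) (metis (full_types))+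
    ultimately show "continuous_map X ?D (\<lambda>x. g \<in> f x)"
      using clopen by (auto simp: continuous_map_def)
  qed
  have prod: "continuous_map X ?P (?\<chi> \<circ> f) \<longleftrightarrow> (\<forall>g\<in>carrier G. continuous_map X ?D (\<lambda>x. g \<in> f x))"
    by (auto simp: continuous_map_componentwise extensional_def)
  show ?thesis
  proof
    assume cont: ?lhs
    have "continuous_map (Sub_topology G) ?P (id \<circ> ?\<chi>)"
      unfolding Sub_topology_def by (rule continuous_map_pullback) auto
    then have "continuous_map X ?P (?\<chi> \<circ> f)"
      using continuous_map_compose[OF cont] by simp
    then show ?rhs
      using cont prod coord by (auto simp: continuous_map_def)
  next
    assume ?rhs
    then show ?lhs
      unfolding Sub_topology_def
      by (intro continuous_map_pullback') (use prod coord in auto)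
  qed
qed

lemma clopen_mem_Sub:
  assumes "g \<in> carrier G"
  shows "openin (Sub_topology G) {H \<in> subgroups_of G. g \<in> H}"
    and "closedin (Sub_topology G) {H \<in> subgroups_of G. g \<in> H}"
  using continuous_map_into_Sub[of "Sub_topology G" G id] assms by auto

lemma openin_superset_Sub:
  assumes "finite F" "F \<subseteq> carrier G"
  shows "openin (Sub_topology G) {H \<in> subgroups_of G. F \<subseteq> H}"
  using assms
proof (induction F)
  case empty
  show ?case
    using openin_topspace[of "Sub_topology G"] by simp
next
  case (insert g F)
  then have "{H \<in> subgroups_of G. insert g F \<subseteq> H} =
      {H \<in> subgroups_of G. g \<in> H} \<inter> {H \<in> subgroups_of G. F \<subseteq> H}" by auto
  with insert clopen_mem_Sub(1)[of g G] show ?case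
    by auto
qed

lemma closedin_superset_Sub:
  assumes "A \<subseteq> carrier G"
  shows "closedin (Sub_topology G) {H \<in> subgroups_of G. A \<subseteq> H}"
proof (cases "A = {}")
  case True
  then show ?thesis
    using closedin_topspace[of "Sub_topology G"] by simp
next
  case False
  then have "{H \<in> subgroups_of G. A \<subseteq> H} = \<Inter>((\<lambda>g. {H \<in> subgroups_of G. g \<in> H}) ` A)" by auto
  then show ?thesis
    using False assms clopen_mem_Sub(2)[of _ G] by (auto intro!: closedin_Inter)
qed

text \<open>The characteristic functions of subgroups form a closed subset of the compact cube
  \<open>{0,1}\<^sup>G\<close>, because each of the group axioms involves only finitely many coordinates.\<close>

lemma (in group) compact_space_Sub: "compact_space (Sub_topology G)"
proof -
  let ?D = "discrete_topology (UNIV :: bool set)"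
  let ?P = "product_topology (\<lambda>_. ?D) (carrier G)"
  let ?S = "\<lambda>f. {g \<in> carrier G. f g}"
  define C where "C = {f \<in> topspace ?P. subgroup (?S f) G}"
  have compact: "compact_space ?P"
    by (simp add: compact_space_product_topology compact_space_discrete_topology)
  have proj: "continuous_map ?P ?D (\<lambda>f. f g)" if "g \<in> carrier G" for g
    using continuous_map_product_projection[OF that, of "\<lambda>_. ?D"] by simp
  have clopen: "openin ?P {f \<in> topspace ?P. f g}" "closedin ?P {f \<in> topspace ?P. f g}"
      "openin ?P {f \<in> topspace ?P. \<not> f g}" "closedin ?P {f \<in> topspace ?P. \<not> f g}"
    if "g \<in> carrier G" for g
    using openin_continuous_map_preimage[OF proj[OF that], of "{True}"]
      openin_continuous_map_preimage[OF proj[OF that], of "{False}"]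
      closedin_continuous_map_preimage[OF proj[OF that], of "{True}"]
      closedin_continuous_map_preimage[OF proj[OF that], of "{False}"] by simp_all
  have subgroup_iff: "subgroup (?S f) G \<longleftrightarrow>
      f \<one> \<and> (\<forall>x\<in>carrier G. \<forall>y\<in>carrier G. \<not> f x \<or> \<not> f y \<or> f (x \<otimes> y)) \<and>
      (\<forall>x\<in>carrier G. \<not> f x \<or> f (inv x))" for f
    by (auto simp: subgroup_def)
  have "C = {f \<in> topspace ?P. f \<one>} \<inter>
      (\<Inter>x\<in>carrier G. \<Inter>y\<in>carrier G. {f \<in> topspace ?P. \<not> f x} \<union> {f \<in> topspace ?P. \<not> f y} \<union>
         {f \<in> topspace ?P. f (x \<otimes> y)}) \<inter>
      (\<Inter>x\<in>carrier G. {f \<in> topspace ?P. \<not> f x} \<union> {f \<in> topspace ?P. f (inv x)})"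
    unfolding C_def subgroup_iff by auto
  also have "closedin ?P \<dots>"
    by (intro closedin_Int closedin_INT closedin_Un clopen) auto
  finally have "compactin ?P C"
    using compact by (rule closedin_compact_space[rotated])
  then have "compactin (subtopology ?P C) C" by simp
  moreover have "continuous_map (subtopology ?P C) (Sub_topology G) ?S"
    unfolding continuous_map_into_Sub
  proof (intro conjI ballI)
    show "?S \<in> topspace (subtopology ?P C) \<rightarrow> subgroups_of G"
      by (auto simp: C_def subgroups_of_def)
    fix g assume g: "g \<in> carrier G"
    have eq: "{f \<in> topspace (subtopology ?P C). g \<in> ?S f} = {f \<in> topspace ?P. f g} \<inter> C"
      using g by auto
    show "openin (subtopology ?P C) {f \<in> topspace (subtopology ?P C). g \<in> ?S f}"
      unfolding eq openin_subtopology using clopen(1)[OF g] by blast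
    show "closedin (subtopology ?P C) {f \<in> topspace (subtopology ?P C). g \<in> ?S f}"
      unfolding eq closedin_subtopology using clopen(2)[OF g] by blast
  qed
  ultimately have "compactin (Sub_topology G) (?S ` C)"
    by (rule image_compactin)
  moreover have "?S ` C = subgroups_of G"
  proof
    show "?S ` C \<subseteq> subgroups_of G"
      by (auto simp: C_def subgroups_of_def)
    show "subgroups_of G \<subseteq> ?S ` C"
    proof
      fix H assume H: "H \<in> subgroups_of G"
      then have "?S (\<lambda>g\<in>carrier G. g \<in> H) = H"
        by (auto simp: subgroups_of_def dest: subgroup.mem_carrier)
      moreover from this H have "(\<lambda>g\<in>carrier G. g \<in> H) \<in> C"
        by (simp add: C_def subgroups_of_def)
      ultimately show "H \<in> ?S ` C" by (intro rev_image_eqI[of "\<lambda>g\<in>carrier G. g \<in> H"]) simp_all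
    qed
  qed
  ultimately show ?thesis
    by (simp add: compact_space_def)
qed

section \<open>The conjugation action\<close>

context group
begin

lemma mem_conj_subgroup:
  assumes "g \<in> carrier G" "H \<subseteq> carrier G"
  shows "x \<in> conj_subgroup G g H \<longleftrightarrow> x \<in> carrier G \<and> inv g \<otimes> x \<otimes> g \<in> H"
proof
  assume "x \<in> conj_subgroup G g H"
  then obtain h where h: "h \<in> H" "x = g \<otimes> h \<otimes> inv g"
    by (auto simp: conj_subgroup_def l_coset_def r_coset_def)
  then have "h \<in> carrier G" using assms(2) by blast
  then have "inv g \<otimes> x \<otimes> g = h" "x \<in> carrier G"
    using assms(1) h(2) by (simp_all flip: m_assoc) (simp add: m_assoc)
  with h(1) show "x \<in> carrier G \<and> inv g \<otimes> x \<otimes> g \<in> H" by simp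
next
  assume x: "x \<in> carrier G \<and> inv g \<otimes> x \<otimes> g \<in> H"
  then have "x = g \<otimes> (inv g \<otimes> x \<otimes> g) \<otimes> inv g"
    using assms by (simp add: m_assoc[symmetric]) (simp add: m_assoc)
  with x show "x \<in> conj_subgroup G g H"
    unfolding conj_subgroup_def l_coset_def r_coset_def by blast
qed

lemma conj_subgroup_closed:
  "g \<in> carrier G \<Longrightarrow> H \<in> subgroups_of G \<Longrightarrow> conj_subgroup G g H \<in> subgroups_of G"
  using subgroup_conjugation_is_surj2 by (simp add: subgroups_of_def conj_subgroup_def)

lemma conj_subgroup_mono: "H \<subseteq> K \<Longrightarrow> conj_subgroup G g H \<subseteq> conj_subgroup G g K"
  by (auto simp: conj_subgroup_def l_coset_def r_coset_def)

lemma subgroups_of_carrier: "H \<in> subgroups_of G \<Longrightarrow> H \<subseteq> carrier G"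
  by (simp add: subgroups_of_def subgroup.subset)

lemma conj_subgroup_one: "H \<in> subgroups_of G \<Longrightarrow> conj_subgroup G \<one> H = H"
  using subgroups_of_carrier[of H] by (auto simp: mem_conj_subgroup subset_iff)

lemma conj_subgroup_mult:
  assumes "g \<in> carrier G" "k \<in> carrier G" "H \<in> subgroups_of G"
  shows "conj_subgroup G g (conj_subgroup G k H) = conj_subgroup G (g \<otimes> k) H"
  using assms subgroups_of_carrier[OF assms(3)]
    subgroups_of_carrier[OF conj_subgroup_closed[OF assms(2,3)]]
  by (auto simp: mem_conj_subgroup inv_mult_group m_assoc)

lemma continuous_map_conj_subgroup:
  assumes "g \<in> carrier G"
  shows "continuous_map (Sub_topology G) (Sub_topology G) (conj_subgroup G g)"
  unfolding continuous_map_into_Sub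
proof (intro conjI ballI)
  show "conj_subgroup G g \<in> topspace (Sub_topology G) \<rightarrow> subgroups_of G"
    using assms conj_subgroup_closed by auto
  fix x assume x: "x \<in> carrier G"
  have "{H \<in> topspace (Sub_topology G). x \<in> conj_subgroup G g H} =
      {H \<in> subgroups_of G. inv g \<otimes> x \<otimes> g \<in> H}"
    using assms x by (auto simp: mem_conj_subgroup subgroups_of_carrier)
  then show "openin (Sub_topology G) {H \<in> topspace (Sub_topology G). x \<in> conj_subgroup G g H}"
      "closedin (Sub_topology G) {H \<in> topspace (Sub_topology G). x \<in> conj_subgroup G g H}"
    using clopen_mem_Sub[of "inv g \<otimes> x \<otimes> g" G] assms x by simp_all
qed

end

definition conj_invariant :: "('a, 'b) monoid_scheme \<Rightarrow> 'a set set \<Rightarrow> bool" where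
  "conj_invariant G X \<longleftrightarrow> (\<forall>g\<in>carrier G. \<forall>H\<in>X. conj_subgroup G g H \<in> X)"

lemma URS_D:
  assumes "URS G X"
  shows "X \<noteq> {}" "closedin (Sub_topology G) X" "conj_invariant G X" "X \<subseteq> subgroups_of G"
  using assms closedin_subset[of "Sub_topology G" X] by (auto simp: URS_def conj_invariant_def)

context group
begin

lemma orbit_invariant:
  assumes "H \<in> subgroups_of G"
  shows "conj_invariant G (orbit G (conj_subgroup G) H)"
  using assms by (auto simp: conj_invariant_def orbit_def conj_subgroup_mult)

lemma orbit_subset:
  "conj_invariant G X \<Longrightarrow> H \<in> X \<Longrightarrow> orbit G (conj_subgroup G) H \<subseteq> X"
  by (auto simp: conj_invariant_def orbit_def)

lemma closure_invariant:
  assumes "conj_invariant G X"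
  shows "conj_invariant G (Sub_topology G closure_of X)"
proof -
  have "conj_subgroup G g H \<in> Sub_topology G closure_of X"
    if g: "g \<in> carrier G" and H: "H \<in> Sub_topology G closure_of X" for g H
  proof -
    have "conj_subgroup G g ` X \<subseteq> X"
      using assms g by (auto simp: conj_invariant_def)
    moreover have "conj_subgroup G g H \<in> Sub_topology G closure_of (conj_subgroup G g ` X)"
      using continuous_map_image_closure_subset[OF continuous_map_conj_subgroup[OF g]] H by blast
    ultimately show ?thesis
      using closure_of_mono by blast
  qed
  then show ?thesis
    by (simp add: conj_invariant_def)
qed

text \<open>The orbit of a point of \<open>A\<close> stays in \<open>A\<close> and is dense in \<open>Y\<close>.\<close>

lemma URS_minimal:
  assumes "URS G Y" "closedin (Sub_topology G) A" "conj_invariant G A" "A \<noteq> {}" "A \<subseteq> Y"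
  shows "A = Y"
proof -
  obtain H where H: "H \<in> A" using assms by blast
  have "Y = subtopology (Sub_topology G) Y closure_of (orbit G (conj_subgroup G) H)"
    using assms(1,5) H by (auto simp: URS_def)
  also have "\<dots> \<subseteq> Sub_topology G closure_of (orbit G (conj_subgroup G) H)"
    by (rule closure_of_subtopology_subset)
  also have "\<dots> \<subseteq> A"
    using orbit_subset[OF assms(3) H] assms(2) by (rule closure_of_minimal)
  finally show ?thesis using assms(5) by blast
qed

lemma URS_orbit_meets_open:
  assumes "URS G Y" "H \<in> Y" "K \<in> Y" "openin (Sub_topology G) U" "K \<in> U"
  obtains g where "g \<in> carrier G" "conj_subgroup G g H \<in> U"
proof -
  have "K \<in> subtopology (Sub_topology G) Y closure_of (orbit G (conj_subgroup G) H)"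
    using assms by (auto simp: URS_def)
  then have "K \<in> Sub_topology G closure_of (orbit G (conj_subgroup G) H)"
    by (rule subsetD[OF closure_of_subtopology_subset])
  then show thesis
    using assms(4,5) that by (auto simp: in_closure_of orbit_def)
qed

end

text \<open>A finite subcover taken from a chain has a largest member.\<close>

lemma compactin_subset_chain_member:
  assumes "compactin X K" "subset.chain UNIV \<C>" "\<C> \<noteq> {}"
    and "\<forall>U\<in>\<C>. openin X U" "K \<subseteq> \<Union>\<C>"
  shows "\<exists>U\<in>\<C>. K \<subseteq> U"
proof -
  obtain \<F> where \<F>: "finite \<F>" "\<F> \<subseteq> \<C>" "K \<subseteq> \<Union>\<F>"
    using assms(1,4,5) unfolding compactin_def by meson
  show ?thesis
  proof (cases "\<F> = {}")
    case True
    with \<F> assms(3) show ?thesis by auto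
  next
    case False
    have "subset.chain UNIV \<F>"
      using assms(2) \<F>(2) by (auto simp: subset_chain_def)
    from Union_in_chain[OF \<F>(1) False this] show ?thesis
      using \<F> by blast
  qed
qed

context group
begin

text \<open>Zorn's lemma, applied to the invariant open sets that fail to cover \<open>Z\<close>, yields a minimal
  closed invariant subset of \<open>Z\<close>; the union of a chain of such open sets still fails to cover
  \<open>Z\<close>, because \<open>Z\<close> is compact.\<close>

lemma exists_URS_subset:
  assumes Z: "closedin (Sub_topology G) Z" "conj_invariant G Z" "Z \<noteq> {}"
  obtains Y where "URS G Y" "Y \<subseteq> Z"
proof -
  let ?T = "Sub_topology G"
  define \<A> where "\<A> = {U. openin ?T U \<and> conj_invariant G U \<and> \<not> Z \<subseteq> U}"
  have compact: "compactin ?T Z"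
    using closedin_compact_space[OF compact_space_Sub Z(1)] .
  have Z_sub: "Z \<subseteq> subgroups_of G"
    using closedin_subset[OF Z(1)] by simp
  have "\<exists>M\<in>\<A>. \<forall>U\<in>\<A>. M \<subseteq> U \<longrightarrow> U = M"
  proof (rule subset_Zorn_nonempty)
    have "{} \<in> \<A>" using Z(3) by (simp add: \<A>_def conj_invariant_def)
    then show "\<A> \<noteq> {}" by blast
    fix \<C> assume \<C>: "\<C> \<noteq> {}" "subset.chain \<A> \<C>"
    then have mem: "\<And>U. U \<in> \<C> \<Longrightarrow> U \<in> \<A>" by (auto simp: subset_chain_def)
    have "\<not> Z \<subseteq> \<Union>\<C>"
    proof
      assume "Z \<subseteq> \<Union>\<C>"
      moreover have "subset.chain UNIV \<C>" using \<C>(2) by (auto simp: subset_chain_def)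
      ultimately obtain U where "U \<in> \<C>" "Z \<subseteq> U"
        using compactin_subset_chain_member[OF compact _ \<C>(1)] mem by (auto simp: \<A>_def)
      then show False using mem by (auto simp: \<A>_def)
    qed
    moreover have "openin ?T (\<Union>\<C>)" using mem by (auto simp: \<A>_def)
    moreover have "conj_invariant G (\<Union>\<C>)"
      using mem by (fastforce simp: \<A>_def conj_invariant_def)
    ultimately show "\<Union>\<C> \<in> \<A>" by (simp add: \<A>_def)
  qed
  then obtain M where M: "M \<in> \<A>" and max: "\<And>U. U \<in> \<A> \<Longrightarrow> M \<subseteq> U \<Longrightarrow> U = M" by blast
  define Y where "Y = Z - M"
  have Y: "Y \<noteq> {}" "closedin ?T Y" "Y \<subseteq> Z"
    using M Z(1) by (auto simp: Y_def \<A>_def closedin_diff)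
  have compl_invariant: "conj_invariant G (subgroups_of G - A)"
    if "conj_invariant G A" for A
    unfolding conj_invariant_def
  proof (intro ballI DiffI)
    fix g H assume g: "g \<in> carrier G" and H: "H \<in> subgroups_of G - A"
    show "conj_subgroup G g H \<in> subgroups_of G" using g H conj_subgroup_closed by blast
    show "conj_subgroup G g H \<notin> A"
    proof
      assume "conj_subgroup G g H \<in> A"
      then have "conj_subgroup G (inv g) (conj_subgroup G g H) \<in> A"
        using that g by (simp add: conj_invariant_def)
      then show False using g H by (simp add: conj_subgroup_mult conj_subgroup_one)
    qed
  qed
  have Y_inv: "conj_invariant G Y"
  proof -
    have "Y = Z \<inter> (subgroups_of G - M)" using Z_sub by (auto simp: Y_def)
    then show ?thesis
      using Z(2) compl_invariant[of M] M by (auto simp: conj_invariant_def \<A>_def)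
  qed
  have "subtopology ?T Y closure_of (orbit G (conj_subgroup G) H) = Y" if H: "H \<in> Y" for H
  proof -
    let ?O = "?T closure_of (orbit G (conj_subgroup G) H)"
    have H_sub: "H \<in> subgroups_of G" using H Y Z_sub by blast
    have O_sub: "?O \<subseteq> Y"
      using orbit_subset[OF Y_inv H] Y(2) by (rule closure_of_minimal)
    have "H \<in> orbit G (conj_subgroup G) H"
      using conj_subgroup_one[OF H_sub] by (force simp: orbit_def)
    then have H_O: "H \<in> ?O"
      using H_sub closure_of_subset_Int[of ?T "orbit G (conj_subgroup G) H"] by auto
    \<comment> \<open>The complement of the orbit closure competes with \<open>M\<close>; maximality of \<open>M\<close> forces \<open>Y = ?O\<close>.\<close>
    have "subgroups_of G - ?O \<in> \<A>"
    proof -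
      have "openin ?T (subgroups_of G - ?O)"
        using closedin_closure_of[of ?T] by (metis closedin_def topspace_Sub_topology)
      then show ?thesis
        using compl_invariant[OF closure_invariant[OF orbit_invariant[OF H_sub]]] H_O O_sub Y(3)
        by (auto simp: \<A>_def)
    qed
    moreover have "M \<subseteq> subgroups_of G - ?O"
    proof -
      have "M \<subseteq> subgroups_of G"
        using M openin_subset[of ?T M] by (simp add: \<A>_def)
      then show ?thesis using O_sub by (auto simp: Y_def)
    qed
    ultimately have "subgroups_of G - ?O = M" by (rule max)
    then have "Y \<subseteq> ?O" using Z_sub by (auto simp: Y_def)
    moreover have "Y \<inter> orbit G (conj_subgroup G) H = orbit G (conj_subgroup G) H"
      using orbit_subset[OF Y_inv H] by blast
    ultimately show ?thesis
      by (simp add: closure_of_subtopology Int_absorb2)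
  qed
  then have "URS G Y"
    using Y Y_inv by (simp add: URS_def conj_invariant_def)
  then show thesis using Y(3) that by blast
qed

text \<open>Zorn's lemma again. If a chain in \<open>Y\<close> had no upper bound in \<open>Y\<close>, the open sets
  \<open>{K. \<not> C \<subseteq> K}\<close>, for \<open>C\<close> in the chain, would cover \<open>Y\<close>. They form a chain themselves, so one of
  them would cover \<open>Y\<close>, although it omits \<open>C\<close>.\<close>

lemma exists_maximal_subgroup_in_closed:
  assumes Y: "closedin (Sub_topology G) Y" "Y \<noteq> {}"
  obtains M where "M \<in> Y" "\<And>K. K \<in> Y \<Longrightarrow> M \<subseteq> K \<Longrightarrow> K = M"
proof -
  let ?T = "Sub_topology G"
  have compact: "compactin ?T Y"
    using closedin_compact_space[OF compact_space_Sub Y(1)] .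
  have Y_sub: "Y \<subseteq> subgroups_of G"
    using closedin_subset[OF Y(1)] by simp
  have "\<exists>M\<in>Y. \<forall>K\<in>Y. M \<subseteq> K \<longrightarrow> K = M"
  proof (rule subset_Zorn)
    fix \<C> assume \<C>: "subset.chain Y \<C>"
    let ?U = "\<lambda>C. {K \<in> subgroups_of G. \<not> C \<subseteq> K}"
    show "\<exists>B\<in>Y. \<forall>C\<in>\<C>. C \<subseteq> B"
    proof (rule ccontr)
      assume no_bound: "\<not> (\<exists>B\<in>Y. \<forall>C\<in>\<C>. C \<subseteq> B)"
      have chain: "subset.chain UNIV (?U ` \<C>)"
        using \<C> by (auto simp: subset_chain_def) blast
      have nonempty: "?U ` \<C> \<noteq> {}" using no_bound Y(2) by auto
      have "open": "\<forall>U\<in>?U ` \<C>. openin ?T U"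
      proof
        fix U assume "U \<in> ?U ` \<C>"
        then obtain C where C: "C \<in> \<C>" "U = ?U C" by blast
        then have "C \<subseteq> carrier G"
          using \<C> Y_sub subgroups_of_carrier by (auto simp: subset_chain_def)
        then have "openin ?T (topspace ?T - {K \<in> subgroups_of G. C \<subseteq> K})"
          by (intro openin_diff openin_topspace closedin_superset_Sub)
        moreover have "U = topspace ?T - {K \<in> subgroups_of G. C \<subseteq> K}" using C(2) by auto
        ultimately show "openin ?T U" by (simp only:)
      qed
      have cover: "Y \<subseteq> \<Union>(?U ` \<C>)"
      proof
        fix K assume "K \<in> Y"
        then have "\<exists>C\<in>\<C>. \<not> C \<subseteq> K" using no_bound by simp
        then obtain C where "C \<in> \<C>" "\<not> C \<subseteq> K" by (rule bexE)
        with \<open>K \<in> Y\<close> Y_sub show "K \<in> \<Union>(?U ` \<C>)" by auto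
      qed
      have "\<exists>U\<in>?U ` \<C>. Y \<subseteq> U"
        using compact chain nonempty "open" cover by (rule compactin_subset_chain_member)
      then obtain C where C: "C \<in> \<C>" "Y \<subseteq> ?U C"
        unfolding bex_simps by (rule bexE)
      then have "C \<in> Y" using \<C> by (auto simp: subset_chain_def)
      then show False using C(2) by blast
    qed
  qed
  then show thesis using that by blast
qed

section \<open>Upper semi-continuous equivariant maps\<close>

text \<open>A pair lies outside this relation exactly when some \<open>g \<in> K\<close> is missing from \<open>f x\<close>; this is an
  open condition on \<open>K\<close> and, by semi-continuity, on \<open>x\<close>. The next two lemmas project the relation
  along a compact factor.\<close>

lemma closedin_semicontinuous_hypograph:
  assumes "upper_semicontinuous_map X G f"
  shows "closedin (prod_topology X (Sub_topology G))
           {(x, K). x \<in> topspace X \<and> K \<in> subgroups_of G \<and> K \<subseteq> f x}"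
proof -
  let ?T = "prod_topology X (Sub_topology G)"
  let ?R = "{(x, K). x \<in> topspace X \<and> K \<in> subgroups_of G \<and> K \<subseteq> f x}"
  have "topspace ?T - ?R =
      (\<Union>g\<in>carrier G. {x \<in> topspace X. f x \<inter> {g} = {}} \<times> {K \<in> subgroups_of G. g \<in> K})"
    using subgroups_of_carrier by fastforce
  moreover have "openin ?T \<dots>"
  proof (rule openin_Union, safe)
    fix g assume g: "g \<in> carrier G"
    have "openin X {x \<in> topspace X. f x \<inter> {g} = {}}"
      using assms g unfolding upper_semicontinuous_map_def by blast
    then show "openin ?T ({x \<in> topspace X. f x \<inter> {g} = {}} \<times> {K \<in> subgroups_of G. g \<in> K})"
      using clopen_mem_Sub(1)[OF g] by (simp add: openin_prod_Times_iff)
  qed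
  ultimately have "openin ?T (topspace ?T - ?R)" by (simp only:)
  moreover have "?R \<subseteq> topspace ?T" by auto
  ultimately show ?thesis by (simp add: closedin_def)
qed

lemma closedin_contains_member:
  assumes f: "upper_semicontinuous_map X G f" and Y: "closedin (Sub_topology G) Y"
  shows "closedin X {x \<in> topspace X. \<exists>K\<in>Y. K \<subseteq> f x}"
proof -
  let ?R = "{(x, K). x \<in> topspace X \<and> K \<in> subgroups_of G \<and> K \<subseteq> f x} \<inter> topspace X \<times> Y"
  have "closedin (prod_topology X (Sub_topology G)) ?R"
    using closedin_semicontinuous_hypograph[OF f] Y
    by (intro closedin_Int) (auto simp: closedin_prod_Times_iff)
  then have "closedin X (fst ` ?R)"
    using closed_map_fst[OF compact_space_Sub, of X] by (simp add: closed_map_def)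
  moreover have "fst ` ?R = {x \<in> topspace X. \<exists>K\<in>Y. K \<subseteq> f x}"
    using closedin_subset[OF Y] by (force simp: image_iff Bex_def)
  ultimately show ?thesis by simp
qed

lemma closedin_contained_in_value:
  assumes f: "upper_semicontinuous_map X G f" and "compact_space X"
  shows "closedin (Sub_topology G) {K \<in> subgroups_of G. \<exists>x\<in>topspace X. K \<subseteq> f x}"
proof -
  let ?R = "{(x, K). x \<in> topspace X \<and> K \<in> subgroups_of G \<and> K \<subseteq> f x}"
  have "closedin (Sub_topology G) (snd ` ?R)"
    using closedin_semicontinuous_hypograph[OF f] closed_map_snd[OF assms(2), of "Sub_topology G"]
    by (simp add: closed_map_def)
  moreover have "snd ` ?R = {K \<in> subgroups_of G. \<exists>x\<in>topspace X. K \<subseteq> f x}" by force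
  ultimately show ?thesis by simp
qed

lemma upper_semicontinuous_map_singleton:
  assumes "f \<in> topspace X \<rightarrow> subgroups_of G"
    and "\<And>g. g \<in> carrier G \<Longrightarrow> openin X {x \<in> topspace X. g \<notin> f x}"
  shows "upper_semicontinuous_map X G f"
  unfolding upper_semicontinuous_map_def
proof (intro conjI allI impI assms(1))
  fix K assume "finite K \<and> K \<subseteq> carrier G"
  then have "finite K" "K \<subseteq> carrier G" by auto
  then show "openin X {x \<in> topspace X. f x \<inter> K = {}}"
  proof (induction K)
    case empty
    show ?case by simp
  next
    case (insert g K)
    then have "{x \<in> topspace X. f x \<inter> insert g K = {}} =
        {x \<in> topspace X. g \<notin> f x} \<inter> {x \<in> topspace X. f x \<inter> K = {}}" by auto
    with insert assms(2)[of g] show ?case by auto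
  qed
qed

text \<open>Taking the inclusion as the semi-continuous map turns the projection lemmas into statements
  about the containment order between two closed sets of subgroups.\<close>

lemma upper_semicontinuous_map_inclusion:
  assumes "S \<subseteq> subgroups_of G"
  shows "upper_semicontinuous_map (subtopology (Sub_topology G) S) G (\<lambda>H. H)"
proof (rule upper_semicontinuous_map_singleton)
  show "(\<lambda>H. H) \<in> topspace (subtopology (Sub_topology G) S) \<rightarrow> subgroups_of G" by auto
  fix g assume g: "g \<in> carrier G"
  have "{H \<in> topspace (subtopology (Sub_topology G) S). g \<notin> H} =
      (topspace (Sub_topology G) - {H \<in> subgroups_of G. g \<in> H}) \<inter> S" by auto
  moreover have "openin (Sub_topology G) (topspace (Sub_topology G) - {H \<in> subgroups_of G. g \<in> H})"
    using clopen_mem_Sub(2)[OF g] by blast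
  ultimately show "openin (subtopology (Sub_topology G) S)
      {H \<in> topspace (subtopology (Sub_topology G) S). g \<notin> H}"
    unfolding openin_subtopology by blast
qed

text \<open>The \<open>H\<close> for which \<open>f H\<close> contains an element of \<open>Y\<close> form a closed invariant subset of \<open>X\<close>, so by
  minimality a single instance suffices.\<close>

lemma URS_contains_member:
  assumes X: "URS G X" and f: "upper_semicontinuous_map (subtopology (Sub_topology G) X) G f"
    and equivariant: "\<And>g H. g \<in> carrier G \<Longrightarrow> H \<in> X \<Longrightarrow> f (conj_subgroup G g H) = conj_subgroup G g (f H)"
    and Y: "closedin (Sub_topology G) Y" "conj_invariant G Y"
    and pair: "H\<^sub>0 \<in> X" "K\<^sub>0 \<in> Y" "K\<^sub>0 \<subseteq> f H\<^sub>0"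
    and "H \<in> X"
  shows "\<exists>K\<in>Y. K \<subseteq> f H"
proof -
  let ?A = "{H \<in> X. \<exists>K\<in>Y. K \<subseteq> f H}"
  have top: "topspace (subtopology (Sub_topology G) X) = X"
    using URS_D(4)[OF X] by auto
  have "closedin (subtopology (Sub_topology G) X) ?A"
    using closedin_contains_member[OF f Y(1)] unfolding top .
  then have "closedin (Sub_topology G) ?A"
    using closedin_trans_full URS_D(2)[OF X] by blast
  moreover have "conj_invariant G ?A"
    using URS_D(3)[OF X] Y(2) equivariant conj_subgroup_mono
    unfolding conj_invariant_def by (smt (verit) mem_Collect_eq)
  ultimately have "?A = X"
    using URS_minimal[OF X] pair by blast
  then show ?thesis using \<open>H \<in> X\<close> by blast
qed

text \<open>URSs in the closure \<open>?Z\<close> of the image are compared by containment of their elements. Any two are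
  comparable in both directions, and a maximal element of one of them then lies in the other.\<close>

lemma unique_URS_of_semicontinuous_map:
  assumes X: "URS G X" and f: "upper_semicontinuous_map (subtopology (Sub_topology G) X) G f"
    and equivariant: "\<And>g H. g \<in> carrier G \<Longrightarrow> H \<in> X \<Longrightarrow> f (conj_subgroup G g H) = conj_subgroup G g (f H)"
  shows "\<exists>!Y. URS G Y \<and> Y \<subseteq> Sub_topology G closure_of (f ` X)"
proof -
  let ?Z = "Sub_topology G closure_of (f ` X)"
  have top: "topspace (subtopology (Sub_topology G) X) = X"
    using URS_D(4)[OF X] by auto
  have f_sub: "f ` X \<subseteq> subgroups_of G"
    using f unfolding upper_semicontinuous_map_def top by auto
  have "conj_invariant G (f ` X)"
    using URS_D(3)[OF X] equivariant[symmetric] by (auto simp: conj_invariant_def)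
  then have Z_inv: "conj_invariant G ?Z" by (rule closure_invariant)
  have "?Z \<noteq> {}"
    using URS_D(1)[OF X] closure_of_subset[of "f ` X" "Sub_topology G"] f_sub by auto
  with Z_inv obtain Y where Y: "URS G Y" "Y \<subseteq> ?Z"
    using exists_URS_subset[OF closedin_closure_of] by blast
  have compact: "compact_space (subtopology (Sub_topology G) S)" if "closedin (Sub_topology G) S" for S
    using closedin_compact_space[OF compact_space_Sub that] by (rule compact_space_subtopology)
  have Z_below: "\<exists>H\<in>X. K \<subseteq> f H" if "K \<in> ?Z" for K
  proof -
    let ?A = "{K \<in> subgroups_of G. \<exists>H\<in>X. K \<subseteq> f H}"
    have "closedin (Sub_topology G) ?A"
      using closedin_contained_in_value[OF f compact[OF URS_D(2)[OF X]]] unfolding top .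
    moreover have "f ` X \<subseteq> ?A" using f_sub by auto
    ultimately have "?Z \<subseteq> ?A" by (simp add: closure_of_minimal)
    then show ?thesis using that by blast
  qed
  have above: "\<exists>K\<in>Y\<^sub>1. K \<subseteq> L" if Y1: "URS G Y\<^sub>1" "Y\<^sub>1 \<subseteq> ?Z" and L: "L \<in> ?Z" for Y\<^sub>1 L
  proof -
    obtain K\<^sub>0 where K0: "K\<^sub>0 \<in> Y\<^sub>1" using URS_D(1)[OF Y1(1)] by blast
    then obtain H\<^sub>0 where H0: "H\<^sub>0 \<in> X" "K\<^sub>0 \<subseteq> f H\<^sub>0" using Z_below Y1(2) by blast
    let ?A = "{L \<in> subgroups_of G. \<exists>K\<in>Y\<^sub>1. K \<subseteq> L}"
    have "f ` X \<subseteq> ?A"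
      using URS_contains_member[OF X f equivariant URS_D(2,3)[OF Y1(1)] H0(1) K0 H0(2)] f_sub
      by auto
    moreover have "closedin (Sub_topology G) ?A"
      using closedin_contains_member[OF upper_semicontinuous_map_inclusion[OF order_refl]
          URS_D(2)[OF Y1(1)]] subtopology_topspace[of "Sub_topology G"] by simp
    ultimately have "?Z \<subseteq> ?A" by (simp add: closure_of_minimal)
    then show ?thesis using L by blast
  qed
  have below: "\<exists>L\<in>Y\<^sub>2. K \<subseteq> L"
    if Y1: "URS G Y\<^sub>1" "Y\<^sub>1 \<subseteq> ?Z" and Y2: "URS G Y\<^sub>2" "Y\<^sub>2 \<subseteq> ?Z" and K: "K \<in> Y\<^sub>1" for Y\<^sub>1 Y\<^sub>2 K
  proof -
    \<comment> \<open>\<open>above\<close> provides one pair \<open>K \<subseteq> L\<close>; minimality of \<open>Y\<^sub>1\<close> spreads it to all of \<open>Y\<^sub>1\<close>.\<close>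
    let ?A = "{K \<in> subgroups_of G. \<exists>L\<in>Y\<^sub>2. K \<subseteq> L}"
    have top2: "topspace (subtopology (Sub_topology G) Y\<^sub>2) = Y\<^sub>2"
      using URS_D(4)[OF Y2(1)] by auto
    have "closedin (Sub_topology G) ?A"
      using closedin_contained_in_value[OF upper_semicontinuous_map_inclusion[OF URS_D(4)[OF Y2(1)]]
          compact[OF URS_D(2)[OF Y2(1)]]] unfolding top2 .
    then have "closedin (Sub_topology G) (Y\<^sub>1 \<inter> ?A)"
      using URS_D(2)[OF Y1(1)] by blast
    moreover have "conj_invariant G (Y\<^sub>1 \<inter> ?A)"
      unfolding conj_invariant_def
    proof (intro ballI)
      fix g K assume g: "g \<in> carrier G" and "K \<in> Y\<^sub>1 \<inter> ?A"
      then obtain L where "K \<in> Y\<^sub>1" "K \<in> subgroups_of G" "L \<in> Y\<^sub>2" "K \<subseteq> L" by blast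
      with g have "conj_subgroup G g K \<in> Y\<^sub>1" "conj_subgroup G g K \<in> subgroups_of G"
          "conj_subgroup G g L \<in> Y\<^sub>2" "conj_subgroup G g K \<subseteq> conj_subgroup G g L"
        using URS_D(3)[OF Y1(1)] URS_D(3)[OF Y2(1)] conj_subgroup_mono conj_subgroup_closed
        by (auto simp: conj_invariant_def)
      then show "conj_subgroup G g K \<in> Y\<^sub>1 \<inter> ?A" by blast
    qed
    moreover have "Y\<^sub>1 \<inter> ?A \<noteq> {}"
    proof -
      obtain L where "L \<in> Y\<^sub>2" using URS_D(1)[OF Y2(1)] by blast
      then show ?thesis using above[OF Y1, of L] Y2(2) URS_D(4)[OF Y1(1)] by blast
    qed
    ultimately have "Y\<^sub>1 \<inter> ?A = Y\<^sub>1" using URS_minimal[OF Y1(1)] by blast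
    then show ?thesis using K by blast
  qed
  have "Y\<^sub>1 = Y\<^sub>2" if Y1: "URS G Y\<^sub>1" "Y\<^sub>1 \<subseteq> ?Z" and Y2: "URS G Y\<^sub>2" "Y\<^sub>2 \<subseteq> ?Z" for Y\<^sub>1 Y\<^sub>2
  proof -
    obtain M where M: "M \<in> Y\<^sub>1" "\<And>K. K \<in> Y\<^sub>1 \<Longrightarrow> M \<subseteq> K \<Longrightarrow> K = M"
      using exists_maximal_subgroup_in_closed URS_D(1,2)[OF Y1(1)] by blast
    obtain L where L: "L \<in> Y\<^sub>2" "M \<subseteq> L" using below[OF Y1 Y2 M(1)] by blast
    obtain K where K: "K \<in> Y\<^sub>1" "L \<subseteq> K" using below[OF Y2 Y1 L(1)] by blast
    \<comment> \<open>\<open>M \<subseteq> L \<subseteq> K\<close> with \<open>M\<close> maximal in \<open>Y\<^sub>1\<close> collapses to \<open>M = L = K\<close>.\<close>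
    have "M \<in> Y\<^sub>1 \<inter> Y\<^sub>2" using M L K by (metis Int_iff order_trans subset_antisym)
    moreover have "closedin (Sub_topology G) (Y\<^sub>1 \<inter> Y\<^sub>2)" "conj_invariant G (Y\<^sub>1 \<inter> Y\<^sub>2)"
      using URS_D(2,3)[OF Y1(1)] URS_D(2,3)[OF Y2(1)] by (auto simp: conj_invariant_def)
    ultimately show ?thesis
      using URS_minimal[OF Y1(1)] URS_minimal[OF Y2(1)] by blast
  qed
  with Y show ?thesis by blast
qed

section \<open>The closure for a filtering family of normal subgroups\<close>

lemma mem_set_mult_iff:
  assumes "N \<lhd> G" "H \<in> subgroups_of G"
  shows "x \<in> H <#> N \<longleftrightarrow> x \<in> carrier G \<and> (x <# N) \<inter> H \<noteq> {}"
proof -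
  interpret N: normal N G by fact
  note H = subgroups_of_carrier[OF assms(2)]
  show ?thesis
  proof
    assume "x \<in> H <#> N"
    then obtain h n where hn: "h \<in> H" "n \<in> N" "x = h \<otimes> n" by (auto simp: set_mult_def)
    then have "x \<otimes> inv n = h" using H by (auto simp: m_assoc)
    then have "h \<in> (x <# N) \<inter> H" using hn by (auto simp: l_coset_def intro!: bexI[of _ "inv n"])
    then show "x \<in> carrier G \<and> (x <# N) \<inter> H \<noteq> {}" using hn H by auto
  next
    assume "x \<in> carrier G \<and> (x <# N) \<inter> H \<noteq> {}"
    then obtain n where n: "x \<in> carrier G" "n \<in> N" "x \<otimes> n \<in> H" by (auto simp: l_coset_def)
    then have "x = (x \<otimes> n) \<otimes> inv n" by (simp add: m_assoc)
    with n show "x \<in> H <#> N" by (auto simp: set_mult_def)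
  qed
qed

lemma coset_closure_eq_Inter:
  assumes "\<N> \<noteq> {}" "filtering \<N>" and normal: "\<And>N. N \<in> \<N> \<Longrightarrow> N \<lhd> G"
    and H: "H \<in> subgroups_of G"
  shows "coset_closure G \<N> H = (\<Inter>N\<in>\<N>. H <#> N)"
proof -
  let ?B = "{g <# N | g N. g \<in> carrier G \<and> N \<in> \<N>}"
  have self: "x \<in> x <# N" if "x \<in> carrier G" "N \<in> \<N>" for x N
    using subgroup.one_closed[OF normal_imp_subgroup[OF normal[OF that(2)]]] that(1)
    by (auto simp: l_coset_def intro!: bexI[of _ \<one>])
  have sub: "x <# N \<subseteq> carrier G" if "x \<in> carrier G" "N \<in> \<N>" for x N
    using normal[OF that(2)] that(1) by (simp add: l_coset_subset_G normal_imp_subgroup subgroup.subset)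
  have top: "topspace (coset_topology G \<N>) = carrier G"
    unfolding coset_topology_def topology_generated_by_topspace
  proof
    show "\<Union>?B \<subseteq> carrier G" using sub by blast
    show "carrier G \<subseteq> \<Union>?B" using self assms(1) by blast
  qed
  \<comment> \<open>Here filtering makes the cosets a base and not merely a subbase.\<close>
  have base: "\<exists>N\<in>\<N>. x <# N \<subseteq> U" if "generate_topology_on ?B U" "x \<in> U" for x U
    using that
  proof (induction arbitrary: x)
    case Empty
    then show ?case by simp
  next
    case (Int a b)
    then obtain N1 N2 where N12: "N1 \<in> \<N>" "N2 \<in> \<N>" "x <# N1 \<subseteq> a" "x <# N2 \<subseteq> b" by blast
    then obtain N3 where "N3 \<in> \<N>" "N3 \<subseteq> N1 \<inter> N2"
      using assms(2) unfolding filtering_def by meson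
    moreover from this have "x <# N3 \<subseteq> (x <# N1) \<inter> (x <# N2)" by (auto simp: l_coset_def)
    ultimately show ?case using N12 by blast
  next
    case (UN K)
    then show ?case by blast
  next
    case (Basis s)
    then obtain g N where s: "s = g <# N" "g \<in> carrier G" "N \<in> \<N>" by blast
    then have "x <# N = s"
      using Basis(2) normal[OF s(3)] l_repr_independence normal_imp_subgroup by metis
    with s show ?case by blast
  qed
  have "x \<in> coset_closure G \<N> H \<longleftrightarrow> x \<in> (\<Inter>N\<in>\<N>. H <#> N)" for x
  proof
    assume x: "x \<in> coset_closure G \<N> H"
    then have xG: "x \<in> carrier G" by (simp add: coset_closure_def in_closure_of top)
    show "x \<in> (\<Inter>N\<in>\<N>. H <#> N)"
    proof
      fix N assume N: "N \<in> \<N>"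
      have "openin (coset_topology G \<N>) (x <# N)"
        unfolding coset_topology_def using xG N by (intro topology_generated_by_Basis) blast
      then have "(x <# N) \<inter> H \<noteq> {}"
        using x self[OF xG N] by (auto simp: coset_closure_def in_closure_of)
      then show "x \<in> H <#> N" using mem_set_mult_iff[OF normal[OF N] H] xG by blast
    qed
  next
    assume x: "x \<in> (\<Inter>N\<in>\<N>. H <#> N)"
    then have meets: "x \<in> carrier G \<and> (x <# N) \<inter> H \<noteq> {}" if "N \<in> \<N>" for N
      using mem_set_mult_iff[OF normal[OF that] H] that by blast
    show "x \<in> coset_closure G \<N> H"
      unfolding coset_closure_def in_closure_of top
    proof (intro conjI allI impI)
      show "x \<in> carrier G" using meets assms(1) by blast
      fix U assume U: "x \<in> U \<and> openin (coset_topology G \<N>) U"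
      then have "generate_topology_on ?B U"
        unfolding coset_topology_def using openin_topology_generated_by by blast
      then obtain N where "N \<in> \<N>" "x <# N \<subseteq> U" using base U by blast
      then show "\<exists>y. y \<in> H \<and> y \<in> U" using meets[of N] by blast
    qed
  qed
  then show ?thesis by blast
qed

lemma set_mult_subgroups_of:
  assumes "N \<lhd> G" "H \<in> subgroups_of G"
  shows "H <#> N \<in> subgroups_of G"
  using mult_norm_subgroup[of N H] commut_normal[of H N] assms by (simp add: subgroups_of_def)

lemma conj_set_mult:
  assumes "N \<lhd> G" "H \<in> subgroups_of G" "g \<in> carrier G"
  shows "conj_subgroup G g H <#> N = conj_subgroup G g (H <#> N)"
proof -
  interpret N: normal N G by fact
  note H = subgroups_of_carrier[OF assms(2)]
  have conj: "x \<in> conj_subgroup G g A \<longleftrightarrow> (\<exists>a\<in>A. x = g \<otimes> a \<otimes> inv g)" for x A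
    by (auto simp: conj_subgroup_def l_coset_def r_coset_def)
  show ?thesis
  proof (intro equalityI subsetI)
    fix x assume "x \<in> conj_subgroup G g H <#> N"
    then obtain h n where hn: "h \<in> H" "n \<in> N" "x = (g \<otimes> h \<otimes> inv g) \<otimes> n"
      by (auto simp: set_mult_def conj)
    then have "x = g \<otimes> (h \<otimes> (inv g \<otimes> n \<otimes> g)) \<otimes> inv g"
      using assms(3) H by (simp add: m_assoc subset_iff)
    moreover have "inv g \<otimes> n \<otimes> g \<in> N" using N.inv_op_closed1 assms(3) hn(2) by blast
    ultimately show "x \<in> conj_subgroup G g (H <#> N)"
      using hn(1) by (auto simp: set_mult_def conj)
  next
    fix x assume "x \<in> conj_subgroup G g (H <#> N)"
    then obtain h n where hn: "h \<in> H" "n \<in> N" "x = g \<otimes> (h \<otimes> n) \<otimes> inv g"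
      by (auto simp: set_mult_def conj)
    then have "x = (g \<otimes> h \<otimes> inv g) \<otimes> (g \<otimes> n \<otimes> inv g)"
      using assms(3) H by (simp add: m_assoc inv_solve_left subset_iff)
    moreover have "g \<otimes> n \<otimes> inv g \<in> N" using N.inv_op_closed2 assms(3) hn(2) by blast
    ultimately show "x \<in> conj_subgroup G g H <#> N"
      using hn(1) unfolding set_mult_def conj_subgroup_def l_coset_def r_coset_def by blast
  qed
qed

lemma conj_subgroup_inject:
  assumes "g \<in> carrier G" "H \<in> subgroups_of G" "K \<in> subgroups_of G"
    and "conj_subgroup G g H = conj_subgroup G g K"
  shows "H = K"
proof -
  have "conj_subgroup G (inv g) (conj_subgroup G g H) = conj_subgroup G (inv g) (conj_subgroup G g K)"
    using assms(4) by simp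
  then show ?thesis using assms(1-3) by (simp add: conj_subgroup_mult conj_subgroup_one)
qed

text \<open>Writing \<open>HN\<close> as a union of cosets of \<open>N\<close> shows that only finitely many sets \<open>HN\<close> arise when \<open>N\<close>
  has finite index.\<close>

lemma set_mult_eq_Union_rcosets:
  assumes "N \<lhd> G" "H \<in> subgroups_of G"
  shows "H <#> N = \<Union>{C \<in> rcosets N. C \<subseteq> H <#> N}"
proof
  interpret N: normal N G by fact
  note H = subgroups_of_carrier[OF assms(2)]
  show "H <#> N \<subseteq> \<Union>{C \<in> rcosets N. C \<subseteq> H <#> N}"
  proof
    fix x assume "x \<in> H <#> N"
    then obtain h n where hn: "h \<in> H" "n \<in> N" "x = h \<otimes> n" by (auto simp: set_mult_def)
    have "N #> h = h <# N" using N.coset_eq hn(1) H by blast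
    moreover have "x \<in> h <# N" "h <# N \<subseteq> H <#> N" using hn by (auto simp: l_coset_def set_mult_def)
    moreover have "N #> h \<in> rcosets N" using hn(1) H by (auto intro: rcosetsI N.subset)
    ultimately show "x \<in> \<Union>{C \<in> rcosets N. C \<subseteq> H <#> N}" by auto
  qed
qed auto

text \<open>One representative in \<open>H\<close> for each coset of \<open>N\<close> that meets \<open>H\<close> generates \<open>HN\<close> over \<open>N\<close>. Since
  containing these representatives is an open condition on \<open>K\<close>, the map \<open>H \<mapsto> HN\<close> is lower
  semi-continuous.\<close>

lemma set_mult_finite_witness:
  assumes N: "N \<lhd> G" "finite (rcosets N)" and H: "H \<in> subgroups_of G"
  obtains F where "finite F" "F \<subseteq> H"
    "\<And>K. F \<subseteq> K \<Longrightarrow> H <#> N \<subseteq> K <#> N"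
proof -
  interpret N: normal N G by fact
  note HG = subgroups_of_carrier[OF H]
  have "finite ((\<lambda>h. N #> h) ` H)"
    using HG by (intro finite_subset[OF _ N(2)]) (auto intro: rcosetsI N.subset)
  then obtain F where F: "finite F" "F \<subseteq> H" "(\<lambda>h. N #> h) ` H = (\<lambda>h. N #> h) ` F"
    by (metis finite_subset_image order_refl)
  have "H <#> N \<subseteq> K <#> N" if "F \<subseteq> K" for K
  proof
    fix x assume "x \<in> H <#> N"
    then obtain h n where hn: "h \<in> H" "n \<in> N" "x = h \<otimes> n" by (auto simp: set_mult_def)
    then obtain k where k: "k \<in> F" "N #> h = N #> k" using F(3) by blast
    then have "h <# N = k <# N" using N.coset_eq hn(1) F(2) HG by (metis subsetD)
    then have "x \<in> k <# N" using hn by (auto simp: l_coset_def)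
    then show "x \<in> K <#> N" using k(1) that by (auto simp: l_coset_def set_mult_def)
  qed
  with F(1,2) show thesis by (rule that)
qed

text \<open>Minimality makes every value of \<open>H \<mapsto> HN\<close> on a URS inclusion-maximal: a suitable conjugate of \<open>H\<close>
  lies so close to a point \<open>P\<close> of maximal value that its own value contains \<open>PN\<close>, hence equals it.
  Conjugating \<open>HN \<subseteq> KN\<close> accordingly puts \<open>PN\<close> on both sides.\<close>

lemma set_mult_eq_on_URS:
  assumes X: "URS G X" and N: "N \<lhd> G" "finite (rcosets N)"
    and HK: "H \<in> X" "K \<in> X" "H <#> N \<subseteq> K <#> N"
  shows "H <#> N = K <#> N"
proof -
  note X_sub = URS_D(4)[OF X, THEN subsetD]
  have "(\<lambda>H. H <#> N) ` X \<subseteq> Union ` Pow (rcosets N)"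
    using set_mult_eq_Union_rcosets[OF N(1) X_sub] by blast
  then have "finite ((\<lambda>H. H <#> N) ` X)"
    using N(2) by (meson finite_Pow_iff finite_imageI finite_subset)
  moreover have "(\<lambda>H. H <#> N) ` X \<noteq> {}" using HK by blast
  ultimately obtain L where "L \<in> (\<lambda>H. H <#> N) ` X"
      and max: "\<And>M. M \<in> (\<lambda>H. H <#> N) ` X \<Longrightarrow> L \<subseteq> M \<Longrightarrow> M = L"
    using finite_has_maximal by metis
  then obtain P where P: "P \<in> X" "L = P <#> N" by blast
  obtain F where F: "finite F" "F \<subseteq> P"
      "\<And>K. F \<subseteq> K \<Longrightarrow> P <#> N \<subseteq> K <#> N"
    using set_mult_finite_witness[OF N X_sub[OF P(1)]] by blast
  have FG: "F \<subseteq> carrier G" using F(2) subgroups_of_carrier[OF X_sub[OF P(1)]] by blast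
  have "P \<in> {H \<in> subgroups_of G. F \<subseteq> H}" using X_sub[OF P(1)] F(2) by blast
  from URS_orbit_meets_open[OF X HK(1) P(1) openin_superset_Sub[OF F(1) FG] this]
  obtain g where g: "g \<in> carrier G" "conj_subgroup G g H \<in> {H \<in> subgroups_of G. F \<subseteq> H}" by blast
  have conj_X: "conj_subgroup G g H \<in> X" "conj_subgroup G g K \<in> X"
    using URS_D(3)[OF X] g(1) HK by (auto simp: conj_invariant_def)
  have conj_eq: "conj_subgroup G g (H <#> N) = conj_subgroup G g H <#> N"
      "conj_subgroup G g (K <#> N) = conj_subgroup G g K <#> N"
    using conj_set_mult[OF N(1) X_sub g(1)] HK by simp_all
  have below_H: "L \<subseteq> conj_subgroup G g (H <#> N)"
    using F(3) g P(2) conj_eq(1) by auto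
  also have "\<dots> \<subseteq> conj_subgroup G g (K <#> N)"
    using HK(3) by (rule conj_subgroup_mono)
  finally have below_K: "L \<subseteq> conj_subgroup G g (K <#> N)" .
  have "conj_subgroup G g (H <#> N) = L"
    using conj_X(1) conj_eq(1) below_H by (intro max) auto
  moreover have "conj_subgroup G g (K <#> N) = L"
    using conj_X(2) conj_eq(2) below_K by (intro max) auto
  ultimately have "conj_subgroup G g (H <#> N) = conj_subgroup G g (K <#> N)" by simp
  then show ?thesis
    by (rule conj_subgroup_inject[OF g(1) set_mult_subgroups_of[OF N(1) X_sub[OF HK(1)]]
        set_mult_subgroups_of[OF N(1) X_sub[OF HK(2)]]])
qed

text \<open>Near \<open>H\<close> the value \<open>HN\<close> can only grow, and within a URS it cannot grow strictly; so \<open>H \<mapsto> HN\<close> is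
  locally constant there.\<close>

lemma openin_URS_not_mem_set_mult:
  assumes X: "URS G X" and N: "N \<lhd> G" "finite (rcosets N)"
  shows "openin (subtopology (Sub_topology G) X) {H \<in> X. k \<notin> H <#> N}"
proof (subst openin_subopen, intro ballI)
  fix H assume H: "H \<in> {H \<in> X. k \<notin> H <#> N}"
  then have H_sub: "H \<in> subgroups_of G" using URS_D(4)[OF X] by blast
  obtain F where F: "finite F" "F \<subseteq> H"
      "\<And>K. F \<subseteq> K \<Longrightarrow> H <#> N \<subseteq> K <#> N"
    using set_mult_finite_witness[OF N H_sub] by blast
  let ?U = "{K \<in> subgroups_of G. F \<subseteq> K} \<inter> X"
  have "openin (subtopology (Sub_topology G) X) ?U"
    using openin_superset_Sub[OF F(1)] F(2) subgroups_of_carrier[OF H_sub]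
    by (auto simp: openin_subtopology)
  moreover have "H \<in> ?U" using H H_sub F(2) by blast
  moreover have "?U \<subseteq> {H \<in> X. k \<notin> H <#> N}"
    using F(3) H set_mult_eq_on_URS[OF X N] by blast
  ultimately show "\<exists>T. openin (subtopology (Sub_topology G) X) T \<and> H \<in> T \<and> T \<subseteq> {H \<in> X. k \<notin> H <#> N}"
    by blast
qed

lemma upper_semicontinuous_coset_closure:
  assumes "\<N> \<noteq> {}" "filtering \<N>" and normal: "\<And>N. N \<in> \<N> \<Longrightarrow> N \<lhd> G"
    and index: "\<And>N. N \<in> \<N> \<Longrightarrow> finite (rcosets N)" and X: "URS G X"
  shows "upper_semicontinuous_map (subtopology (Sub_topology G) X) G (coset_closure G \<N>)"
proof -
  note X_sub = URS_D(4)[OF X, THEN subsetD]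
  have closure_eq: "coset_closure G \<N> H = (\<Inter>N\<in>\<N>. H <#> N)" if "H \<in> subgroups_of G" for H
    using assms(1,2) normal that by (rule coset_closure_eq_Inter)
  have top: "topspace (subtopology (Sub_topology G) X) = X"
    using URS_D(4)[OF X] by auto
  show ?thesis
  proof (rule upper_semicontinuous_map_singleton, unfold top)
    show "coset_closure G \<N> \<in> X \<rightarrow> subgroups_of G"
    proof
      fix H assume "H \<in> X"
      then have "H <#> N \<in> subgroups_of G" if "N \<in> \<N>" for N
        using set_mult_subgroups_of[OF normal[OF that]] X_sub by blast
      then have "subgroup (\<Inter>N\<in>\<N>. H <#> N) G"
        using assms(1) by (intro subgroups_Inter) (auto simp: subgroups_of_def)
      then show "coset_closure G \<N> H \<in> subgroups_of G"
        using closure_eq X_sub \<open>H \<in> X\<close> by (simp add: subgroups_of_def)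
    qed
    fix g assume "g \<in> carrier G"
    have "{H \<in> X. g \<notin> coset_closure G \<N> H} = (\<Union>N\<in>\<N>. {H \<in> X. g \<notin> H <#> N})"
      using closure_eq X_sub by auto
    then show "openin (subtopology (Sub_topology G) X) {H \<in> X. g \<notin> coset_closure G \<N> H}"
      using openin_URS_not_mem_set_mult[OF X normal index] by auto
  qed
qed

lemma coset_closure_equivariant:
  assumes "\<N> \<noteq> {}" "filtering \<N>" and normal: "\<And>N. N \<in> \<N> \<Longrightarrow> N \<lhd> G"
    and H: "H \<in> subgroups_of G" and g: "g \<in> carrier G"
  shows "coset_closure G \<N> (conj_subgroup G g H) = conj_subgroup G g (coset_closure G \<N> H)"
proof -
  have closure_eq: "coset_closure G \<N> H = (\<Inter>N\<in>\<N>. H <#> N)" if "H \<in> subgroups_of G" for H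
    using assms(1,2) normal that by (rule coset_closure_eq_Inter)
  have HN: "H <#> N \<subseteq> carrier G" if "N \<in> \<N>" for N
    using set_mult_subgroups_of[OF normal[OF that] H] by (rule subgroups_of_carrier)
  then have "(\<Inter>N\<in>\<N>. H <#> N) \<subseteq> carrier G" using assms(1) by blast
  then have "conj_subgroup G g (\<Inter>N\<in>\<N>. H <#> N) = (\<Inter>N\<in>\<N>. conj_subgroup G g (H <#> N))"
    using HN g assms(1) by (auto simp: mem_conj_subgroup)
  also have "\<dots> = (\<Inter>N\<in>\<N>. conj_subgroup G g H <#> N)"
    using conj_set_mult[OF normal H g] by simp
  finally show ?thesis
    using closure_eq[OF H] closure_eq[OF conj_subgroup_closed[OF g H]] by simp
qed

end

theorem proposition1:
  fixes G :: "('a, 'b) monoid_scheme"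
    and \<N> :: "'a set set"
    and \<H> :: "'a set set"
  assumes "group G"
    and "\<N> \<noteq> {}"
    and "filtering \<N>"
    and "\<And>N. N \<in> \<N> \<Longrightarrow> N \<lhd> G"
    and "\<And>N. N \<in> \<N> \<Longrightarrow> finite (rcosets\<^bsub>G\<^esub> N)"
    and "URS G \<H>"
  shows "upper_semicontinuous_map (subtopology (Sub_topology G) \<H>) G (coset_closure G \<N>) \<and>
         (\<exists>!X. URS G X \<and>
               X \<subseteq> Sub_topology G closure_of {coset_closure G \<N> H | H. H \<in> \<H>})"
proof -
  interpret group G by fact
  have usc: "upper_semicontinuous_map (subtopology (Sub_topology G) \<H>) G (coset_closure G \<N>)"
    using assms by (intro upper_semicontinuous_coset_closure)
  have "\<exists>!X. URS G X \<and> X \<subseteq> Sub_topology G closure_of (coset_closure G \<N> ` \<H>)"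
    using assms(6) usc
  proof (rule unique_URS_of_semicontinuous_map)
    fix g H assume "g \<in> carrier G" "H \<in> \<H>"
    then show "coset_closure G \<N> (conj_subgroup G g H) = conj_subgroup G g (coset_closure G \<N> H)"
      using URS_D(4)[OF assms(6)] by (intro coset_closure_equivariant assms) auto
  qed
  moreover have "coset_closure G \<N> ` \<H> = {coset_closure G \<N> H | H. H \<in> \<H>}" by blast
  ultimately show ?thesis using usc by simp
qed

end
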